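(* Let $\mathfrak{L}$ be a finite-dimensional Leibniz algebra over a field $\mathbb{K}$ of characteristic zero and let $L=\mathbf{U}_3(\mathfrak{L})$. The subspace $I_{12}=\mathrm{Span}\{[x,x,y]\mid x,y\in L\}$ of $\mathbf{U}_3(\mathfrak{L})$ is an ideal and is equal to the Leibniz $3$-kernel $\mathrm{Leib}_3(L)$.
   Context: A Leibniz algebra is a vector space $\mathfrak{L}$ with a bilinear bracket satisfying $[[x,y],z]=[[x,z],y]+[x,[y,z]]$. $\mathbf{U}_3(\mathfrak{L})$ is the Leibniz $3$-algebra on the vector space $\mathfrak{L}$ with ternary bracket $[x_1,x_2,x_3]=[x_1,[x_2,x_3]]$. An ideal of a Leibniz $3$-algebra $L$ is a subspace $I$ with $[I,L,L]\subseteq I$, $[L,I,L]\subseteq I$ and $[L,L,I]\subseteq I$. The Leibniz $3$-kernel $\mathrm{Leib}_3(L)$ is the ideal of $L$ generated by all brackets $[x_1,x_2,x_3]$ with $x_i=x_j$ for some $i\neq j$. *)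

theory Defs
  imports Complex_Main
begin

text \<open>
  The bracket satisfies the (right) Leibniz identity: right multiplications are derivations.
  The underlying vector space is the whole type.
\<close>

locale leibniz_algebra = vector_space scale
  for scale :: "'k::field \<Rightarrow> 'v::ab_group_add \<Rightarrow> 'v" +
  fixes bracket :: "'v \<Rightarrow> 'v \<Rightarrow> 'v"
  assumes linear_left: "Vector_Spaces.linear scale scale (\<lambda>x. bracket x y)"
    and linear_right: "Vector_Spaces.linear scale scale (\<lambda>y. bracket x y)"
    and leibniz_identity:
      "bracket (bracket x y) z = bracket (bracket x z) y + bracket x (bracket y z)"

locale leibniz_3_algebra = vector_space scale
  for scale :: "'k::field \<Rightarrow> 'v::ab_group_add \<Rightarrow> 'v" +
  fixes tbracket :: "'v \<Rightarrow> 'v \<Rightarrow> 'v \<Rightarrow> 'v"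
  assumes linear_1: "Vector_Spaces.linear scale scale (\<lambda>x. tbracket x y z)"
    and linear_2: "Vector_Spaces.linear scale scale (\<lambda>y. tbracket x y z)"
    and linear_3: "Vector_Spaces.linear scale scale (\<lambda>z. tbracket x y z)"
    and leibniz_3_identity:
      "tbracket (tbracket x1 x2 x3) y2 y3 =
         tbracket (tbracket x1 y2 y3) x2 x3
       + tbracket x1 (tbracket x2 y2 y3) x3
       + tbracket x1 x2 (tbracket x3 y2 y3)"
begin

text \<open>
  The inclusion \<open>[I,L,L] \<subseteq> I\<close> and its two variants are imposed on single brackets;
  as \<open>I\<close> is a subspace, this is the same as imposing them on spans of brackets.
\<close>

definition ideal3 :: "'v set \<Rightarrow> bool" where
  "ideal3 I \<longleftrightarrow> subspace I \<and>
     (\<forall>a\<in>I. \<forall>x y. tbracket a x y \<in> I \<and> tbracket x a y \<in> I \<and> tbracket x y a \<in> I)"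

text \<open>\<open>ideal3 hull S\<close> is the intersection of all ideals containing \<open>S\<close>.\<close>

definition Leib3 :: "'v set" where
  "Leib3 = ideal3 hull {tbracket x1 x2 x3 | x1 x2 x3. x1 = x2 \<or> x1 = x3 \<or> x2 = x3}"

definition I12 :: "'v set" where
  "I12 = span {tbracket x x y | x y. True}"

lemma ideal3_Inter: "(\<And>I. I \<in> F \<Longrightarrow> ideal3 I) \<Longrightarrow> ideal3 (\<Inter>F)"
  unfolding ideal3_def by (auto intro: subspace_Inter)

lemma ideal3_Leib3: "ideal3 Leib3"
  unfolding Leib3_def by (rule hull_in) (auto intro: ideal3_Inter)

end

definition U3 :: "('v \<Rightarrow> 'v \<Rightarrow> 'v) \<Rightarrow> 'v \<Rightarrow> 'v \<Rightarrow> 'v \<Rightarrow> 'v" where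
  "U3 bracket x1 x2 x3 = bracket x1 (bracket x2 x3)"

context leibniz_algebra
begin

lemma leibniz_3_algebra_U3: "leibniz_3_algebra scale (U3 bracket)"
proof
  have ll: "module_hom scale scale (\<lambda>x. bracket x y)" for y
    using linear_left unfolding linear_iff_module_hom by blast
  have lr: "module_hom scale scale (\<lambda>y. bracket x y)" for x
    using linear_right unfolding linear_iff_module_hom by blast
  note add = module_hom.add[OF ll] module_hom.add[OF lr]
  have der: "bracket (bracket x (bracket y z)) c =
      bracket (bracket x c) (bracket y z) + bracket x (bracket (bracket y c) z)
      + bracket x (bracket y (bracket z c))" for x y z c
    using leibniz_identity[of x "bracket y z" c] leibniz_identity[of y z c]
    by (simp add: add)
  show "U3 bracket (U3 bracket x1 x2 x3) y2 y3 =
      U3 bracket (U3 bracket x1 y2 y3) x2 x3 + U3 bracket x1 (U3 bracket x2 y2 y3) x3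
      + U3 bracket x1 x2 (U3 bracket x3 y2 y3)" for x1 x2 x3 y2 y3
    unfolding U3_def by (rule der)
qed (simp_all add: U3_def linear_left[THEN Vector_Spaces.linear.axioms(3)]
    module_hom.add[OF linear_left[THEN Vector_Spaces.linear.axioms(3)]]
    module_hom.add[OF linear_right[THEN Vector_Spaces.linear.axioms(3)]]
    module_hom.scale[OF linear_left[THEN Vector_Spaces.linear.axioms(3)]]
    module_hom.scale[OF linear_right[THEN Vector_Spaces.linear.axioms(3)]])

end

end

theory Submission
  imports Defs
begin

text \<open>
  Putting \<open>y = z\<close> in the Leibniz identity gives \<open>[x,[y,y]] = 0\<close>, so the ternary bracket
  \<open>[x,[y,z]]\<close> is alternating in its last two arguments. The proposition holds in every Leibniz
  3-algebra with this property; write \<open>I\<close> for \<open>I12\<close>.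

  Polarizing \<open>[x,x,y]\<close> shows that the bracket is skew-symmetric in its first two arguments
  modulo \<open>I\<close>, while it is exactly skew-symmetric in the last two. Hence a bracket with an entry
  in \<open>I\<close> can be rearranged, modulo \<open>I\<close> and up to sign, so that this entry comes first. It is
  then enough that \<open>[I,L,L] \<subseteq> I\<close>, which holds because right multiplication is a derivation \<open>D\<close>
  of the ternary bracket: in
  \<open>D [x,x,y] = ([D x,x,y] + [x,D x,y]) + [x,x,D y]\<close>
  the parenthesis is a polarized generator and the last term is a generator.

  So \<open>I\<close> is an ideal. The generators of the Leibniz 3-kernel are the brackets \<open>[x,x,y]\<close>, the
  brackets \<open>[x,y,x] = - [x,x,y]\<close> and the brackets \<open>[x,y,y] = 0\<close>, so they lie in \<open>I\<close> and span it;
  the ideal they generate is therefore \<open>I\<close> itself.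
\<close>

context leibniz_3_algebra
begin

lemmas tbracket_hom =
  linear_1[unfolded linear_iff_module_hom]
  linear_2[unfolded linear_iff_module_hom]
  linear_3[unfolded linear_iff_module_hom]

lemmas tbracket_add = tbracket_hom[THEN module_hom.add]

lemma subspace_I12: "subspace I12"
  unfolding I12_def by (rule subspace_span)

lemma tbracket_same_12_in_I12: "tbracket x x y \<in> I12"
  unfolding I12_def by (rule span_base) blast

text \<open>Polarization: \<open>[x+y,x+y,z] - [x,x,z] - [y,y,z]\<close> is the sum in question.\<close>

lemma tbracket_swap_12_in_I12: "tbracket x y z + tbracket y x z \<in> I12"
proof -
  have "tbracket x y z + tbracket y x z
      = tbracket (x + y) (x + y) z - tbracket x x z - tbracket y y z"
    by (simp add: tbracket_add algebra_simps)
  also have "\<dots> \<in> I12"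
    by (intro subspace_diff subspace_I12 tbracket_same_12_in_I12)
  finally show ?thesis .
qed

text \<open>
  Right multiplication by \<open>u, v\<close> is a derivation; differentiating the repeated entry of a generator
  gives two terms that form a polarized generator.
\<close>

lemma tbracket_I12_left:
  assumes "a \<in> I12"
  shows "tbracket a u v \<in> I12"
proof -
  have generator: "tbracket (tbracket x x y) u v \<in> I12" for x y
  proof -
    have "tbracket (tbracket x x y) u v
        = (tbracket (tbracket x u v) x y + tbracket x (tbracket x u v) y)
          + tbracket x x (tbracket y u v)"
      by (rule leibniz_3_identity)
    also have "\<dots> \<in> I12"
      by (intro subspace_add subspace_I12 tbracket_swap_12_in_I12 tbracket_same_12_in_I12)
    finally show ?thesis .
  qed
  have "subspace {a. tbracket a u v \<in> I12}"
    using module_hom.subspace_vimage[OF tbracket_hom(1) subspace_I12] by (simp add: vimage_def)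
  then have "span {tbracket x x y | x y. True} \<subseteq> {a. tbracket a u v \<in> I12}"
    by (intro span_minimal) (use generator in blast)+
  then show ?thesis
    using assms unfolding I12_def by blast
qed

lemma tbracket_swap_23:
  assumes "\<And>x y. tbracket x y y = 0"
  shows "tbracket x y z = - tbracket x z y"
proof -
  have "tbracket x y z + tbracket x z y = tbracket x (y + z) (y + z)"
    by (simp add: tbracket_add assms[of x y] assms[of x z])
  also have "\<dots> = 0"
    by (rule assms)
  finally show ?thesis
    by (simp add: eq_neg_iff_add_eq_0)
qed

text \<open>
  The entry from \<open>I12\<close> is moved to the first place, where the previous inclusion applies: the
  middle entry by skew-symmetry modulo \<open>I12\<close>, the last one by first passing to the middle.
\<close>

lemma ideal3_I12:
  assumes alternating: "\<And>x y. tbracket x y y = 0"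
  shows "ideal3 I12"
  unfolding ideal3_def
proof (intro conjI ballI allI)
  show "subspace I12"
    by (rule subspace_I12)
next
  fix a x y
  assume a: "a \<in> I12"
  then show "tbracket a x y \<in> I12"
    by (rule tbracket_I12_left)
  have middle: "tbracket z a w \<in> I12" for z w
    using subspace_diff[OF subspace_I12 tbracket_swap_12_in_I12[of z a w] tbracket_I12_left[OF a, of z w]]
    by simp
  show "tbracket x a y \<in> I12"
    by (rule middle)
  show "tbracket x y a \<in> I12"
    unfolding tbracket_swap_23[OF alternating, of x y a]
    by (intro subspace_neg subspace_I12 middle)
qed

lemma I12_eq_Leib3:
  assumes alternating: "\<And>x y. tbracket x y y = 0"
  shows "I12 = Leib3"
proof
  have "{tbracket x x y | x y. True} \<subseteq> Leib3"
    unfolding Leib3_def by (rule subset_trans[OF _ hull_subset]) blast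
  moreover have "subspace Leib3"
    using ideal3_Leib3 unfolding ideal3_def by blast
  ultimately show "I12 \<subseteq> Leib3"
    unfolding I12_def by (rule span_minimal)
next
  have "tbracket x y x \<in> I12" for x y
    unfolding tbracket_swap_23[OF alternating, of x y x]
    by (intro subspace_neg subspace_I12 tbracket_same_12_in_I12)
  then have "{tbracket x1 x2 x3 | x1 x2 x3. x1 = x2 \<or> x1 = x3 \<or> x2 = x3} \<subseteq> I12"
    using tbracket_same_12_in_I12 alternating subspace_0[OF subspace_I12] by auto
  then show "Leib3 \<subseteq> I12"
    unfolding Leib3_def by (rule hull_minimal) (rule ideal3_I12[OF alternating])
qed

end

text \<open>Right multiplication by a square vanishes: with \<open>y = z\<close> the first two terms of the Leibniz identity agree.\<close>

lemma (in leibniz_algebra) U3_alternating_23: "U3 bracket x y y = 0"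
  using leibniz_identity[of x y y] by (simp add: U3_def)

theorem proposition2p3:
  fixes scale :: "'k::field_char_0 \<Rightarrow> 'v::ab_group_add \<Rightarrow> 'v"
    and bracket :: "'v \<Rightarrow> 'v \<Rightarrow> 'v"
    and Basis :: "'v set"
  assumes "finite_dimensional_vector_space scale Basis"
    and "leibniz_algebra scale bracket"
  shows "leibniz_3_algebra.ideal3 scale (U3 bracket) (leibniz_3_algebra.I12 scale (U3 bracket))
       \<and> leibniz_3_algebra.I12 scale (U3 bracket) = leibniz_3_algebra.Leib3 scale (U3 bracket)"
proof -
  interpret leibniz_algebra scale bracket
    by (rule assms(2))
  interpret U3: leibniz_3_algebra scale "U3 bracket"
    by (rule leibniz_3_algebra_U3)
  show ?thesis
    using U3.ideal3_I12 U3.I12_eq_Leib3 U3_alternating_23 by blast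
qed

end
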